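(* Let $X$ and $Y$ be linear spaces over a field $\mathbb{K}$ and let $f, f_{1,1}, f_{1,2}, f_{2,1}, f_{2,2}\colon X\times Y\to \mathbb{K}$ be functions that all vanish at $(0,0)$. Then \[ f(0,y_{2})=f_{1,1}(x_{1},y_{1})+f_{1,2}(x_{1},y_{2})+f_{2,1}(x_{2},y_{1})+f_{2,2}(x_{2},y_{2}) \qquad (x_{1}, x_{2}\in X,\ y_{1}, y_{2}\in Y) \] holds if and only if for all $i,j\in\{1,2\}$ there exist functions $\chi_{i,j}\colon X\to \mathbb{K}$ and $\zeta_{i,j}\colon Y\to \mathbb{K}$ vanishing at $0$ such that \[ f_{i,j}(x,z)=\chi_{i,j}(x)+\zeta_{i,j}(z) \qquad (x\in X,\ z\in Y,\ i,j=1,2) \] and \[ \chi_{1,2}(x)+\chi_{1,1}(x)=0,\quad \chi_{2,2}(x)+\chi_{2,1}(x)=0,\quad \zeta_{2,1}(z)+\zeta_{1,1}(z)=0,\quad \zeta_{2,2}(z)+\zeta_{1,2}(z)=f(0,z) \qquad (x\in X,\ z\in Y). \] *)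

theory Defs
  imports Complex_Main
begin

end

theory Submission
  imports Defs
begin

text \<open>
  In the equation each summand carries one of the two first arguments and one of the two second
  arguments, so any summand can be isolated by putting 0 for the two variables it does not contain;
  the others then depend on at most one variable each. Putting 0 for a third variable as well
  identifies these one-variable functions with traces of the isolated summand on the axes, up to
  sign and up to the left-hand side. Hence every summand \<open>g\<close> splits as
  \<open>g (x, z) = g (x, 0) + g (0, z)\<close>, and the traces on the axes satisfy the four linear relations.
  They therefore serve as the functions \<open>\<chi>\<close> and \<open>\<zeta>\<close>. For the converse, inserting the
  split form makes everything except the left-hand side cancel.
\<close>

text \<open>
  Each variable occurs in exactly two summands, so keeping one of the four and putting 0 for the
  other three leaves a relation between two traces on an axis. The functions \<open>a\<close>, \<open>b\<close>, \<open>c\<close>, \<open>d\<close>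
  stand for the indices 11, 12, 21, 22, and \<open>h\<close> for the left-hand side as a function
  of \<open>y2\<close>.
\<close>

lemma axis_relations:
  fixes a b c d :: "'x::zero \<times> 'y::zero \<Rightarrow> 'k::ab_group_add"
  assumes eq: "\<And>x1 x2 y1 y2. h y2 = a (x1, y1) + b (x1, y2) + c (x2, y1) + d (x2, y2)"
    and zero: "a (0, 0) = 0" "b (0, 0) = 0" "c (0, 0) = 0" "d (0, 0) = 0"
  shows "b (x, 0) + a (x, 0) = 0" "d (x, 0) + c (x, 0) = 0"
    and "c (0, z) + a (0, z) = 0" "d (0, z) + b (0, z) = h z"
proof -
  have h0: "h 0 = 0"
    using eq[of 0 0 0 0] zero by simp
  show "b (x, 0) + a (x, 0) = 0"
    using eq[of 0 x 0 0] h0 zero by (simp add: add.commute)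
  show "d (x, 0) + c (x, 0) = 0"
    using eq[of 0 0 0 x] h0 zero by (simp add: add.commute)
  show "c (0, z) + a (0, z) = 0"
    using eq[of 0 0 z 0] h0 zero by (simp add: add.commute)
  show "d (0, z) + b (0, z) = h z"
    using eq[of z 0 0 0] zero by (simp add: add.commute)
qed

text \<open>
  Isolating a summand expresses it through the other three on the axes; the relations above turn
  these into the axis values of the summand itself.
\<close>

lemma splits_along_axes:
  fixes a b c d :: "'x::zero \<times> 'y::zero \<Rightarrow> 'k::ab_group_add"
  assumes eq: "\<And>x1 x2 y1 y2. h y2 = a (x1, y1) + b (x1, y2) + c (x2, y1) + d (x2, y2)"
    and zero: "a (0, 0) = 0" "b (0, 0) = 0" "c (0, 0) = 0" "d (0, 0) = 0"
  shows "a (x, z) = a (x, 0) + a (0, z)" "b (x, z) = b (x, 0) + b (0, z)"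
    and "c (x, z) = c (x, 0) + c (0, z)" "d (x, z) = d (x, 0) + d (0, z)"
proof -
  note axis = axis_relations[where h = h and a = a and b = b and c = c and d = d, OF eq zero]
  have h0: "h 0 = 0"
    using eq[of 0 0 0 0] zero by simp
  have "a (x, z) + b (x, 0) + c (0, z) = 0"
    using eq[of 0 x z 0] h0 zero by simp
  then show "a (x, z) = a (x, 0) + a (0, z)"
    using axis(1)[of x] axis(3)[of z] by (simp add: add_eq_0_iff algebra_simps)
  have "a (x, 0) + b (x, z) + d (0, z) = d (0, z) + b (0, z)"
    using eq[of z x 0 0] axis(4)[of z] zero by simp
  then show "b (x, z) = b (x, 0) + b (0, z)"
    using axis(1)[of x] by (simp add: add_eq_0_iff algebra_simps)
  have "a (0, z) + c (x, z) + d (x, 0) = 0"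
    using eq[of 0 0 z x] h0 zero by simp
  then show "c (x, z) = c (x, 0) + c (0, z)"
    using axis(2)[of x] axis(3)[of z] by (simp add: add_eq_0_iff algebra_simps)
  have "b (0, z) + c (x, 0) + d (x, z) = d (0, z) + b (0, z)"
    using eq[of z 0 0 x] axis(4)[of z] zero by simp
  then show "d (x, z) = d (x, 0) + d (0, z)"
    using axis(2)[of x] by (simp add: add_eq_0_iff algebra_simps)
qed

theorem proposition3:
  fixes scaleX :: "'k::field \<Rightarrow> 'x::ab_group_add \<Rightarrow> 'x"
    and scaleY :: "'k \<Rightarrow> 'y::ab_group_add \<Rightarrow> 'y"
    and f :: "'x \<times> 'y \<Rightarrow> 'k"
    and F :: "nat \<Rightarrow> nat \<Rightarrow> 'x \<times> 'y \<Rightarrow> 'k"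
  assumes "vector_space scaleX"
    and "vector_space scaleY"
    and "f (0, 0) = 0"
    and "\<forall>i\<in>{1,2}. \<forall>j\<in>{1,2}. F i j (0, 0) = 0"
  shows "(\<forall>x1 x2 y1 y2.
            f (0, y2) = F 1 1 (x1, y1) + F 1 2 (x1, y2) + F 2 1 (x2, y1) + F 2 2 (x2, y2))
     \<longleftrightarrow>
         (\<exists>(\<chi> :: nat \<Rightarrow> nat \<Rightarrow> 'x \<Rightarrow> 'k) (\<zeta> :: nat \<Rightarrow> nat \<Rightarrow> 'y \<Rightarrow> 'k).
            (\<forall>i\<in>{1,2}. \<forall>j\<in>{1,2}. \<chi> i j 0 = 0 \<and> \<zeta> i j 0 = 0) \<and>
            (\<forall>i\<in>{1,2}. \<forall>j\<in>{1,2}. \<forall>x z. F i j (x, z) = \<chi> i j x + \<zeta> i j z) \<and>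
            (\<forall>x. \<chi> 1 2 x + \<chi> 1 1 x = 0) \<and>
            (\<forall>x. \<chi> 2 2 x + \<chi> 2 1 x = 0) \<and>
            (\<forall>z. \<zeta> 2 1 z + \<zeta> 1 1 z = 0) \<and>
            (\<forall>z. \<zeta> 2 2 z + \<zeta> 1 2 z = f (0, z)))"
    (is "?L \<longleftrightarrow> ?R")
proof
  assume ?L
  then have eq: "\<And>x1 x2 y1 y2.
      f (0, y2) = F 1 1 (x1, y1) + F 1 2 (x1, y2) + F 2 1 (x2, y1) + F 2 2 (x2, y2)"
    by blast
  have zero: "F 1 1 (0, 0) = 0" "F 1 2 (0, 0) = 0" "F 2 1 (0, 0) = 0" "F 2 2 (0, 0) = 0"
    using assms(4) by blast+
  note axis = axis_relations[where h = "\<lambda>z. f (0, z)" and a = "F 1 1" and b = "F 1 2"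
      and c = "F 2 1" and d = "F 2 2", OF eq zero]
  note split = splits_along_axes[where h = "\<lambda>z. f (0, z)" and a = "F 1 1" and b = "F 1 2"
      and c = "F 2 1" and d = "F 2 2", OF eq zero]
  have "\<forall>i\<in>{1,2}. \<forall>j\<in>{1,2}. \<forall>x z. F i j (x, z) = F i j (x, 0) + F i j (0, z)"
    using split by blast
  with assms(4) axis show ?R
    by (intro exI[of _ "\<lambda>i j x. F i j (x, 0)"] exI[of _ "\<lambda>i j z. F i j (0, z)"]) blast
next
  assume ?R
  then obtain \<chi> :: "nat \<Rightarrow> nat \<Rightarrow> 'x \<Rightarrow> 'k" and \<zeta> :: "nat \<Rightarrow> nat \<Rightarrow> 'y \<Rightarrow> 'k" where
    split: "\<forall>i\<in>{1,2}. \<forall>j\<in>{1,2}. \<forall>x z. F i j (x, z) = \<chi> i j x + \<zeta> i j z"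
    and rel: "\<And>x. \<chi> 1 2 x + \<chi> 1 1 x = 0" "\<And>x. \<chi> 2 2 x + \<chi> 2 1 x = 0"
      "\<And>z. \<zeta> 2 1 z + \<zeta> 1 1 z = 0" "\<And>z. \<zeta> 2 2 z + \<zeta> 1 2 z = f (0, z)"
    by blast
  show ?L
  proof (intro allI)
    fix x1 x2 y1 y2
    have "F 1 1 (x1, y1) + F 1 2 (x1, y2) + F 2 1 (x2, y1) + F 2 2 (x2, y2)
        = (\<chi> 1 2 x1 + \<chi> 1 1 x1) + (\<chi> 2 2 x2 + \<chi> 2 1 x2)
          + (\<zeta> 2 1 y1 + \<zeta> 1 1 y1) + (\<zeta> 2 2 y2 + \<zeta> 1 2 y2)"
      using split by (simp add: algebra_simps)
    then show "f (0, y2) = F 1 1 (x1, y1) + F 1 2 (x1, y2) + F 2 1 (x2, y1) + F 2 2 (x2, y2)"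
      by (simp only: rel add_0_left)
  qed
qed

end
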